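(* Let $r>1$ be a rational number, and for $c\in\mathbb{R}$ let $f_c:\mathbb{R}\to\mathbb{R}$, $f_c(x)=|x|^r+c$. Let $c\in\mathbb{R}$ be an algebraic integer and let $n\geq 1$ be an integer such that $f_c^j(0)\neq 0$ for all integers $j\in[1,n-1]$. Then $D_c(f_c^n(0))\neq 0$.
   Context: $f_c^n$ denotes the $n$-fold iterate of $f_c$ (composition with itself $n$ times). For fixed $r$ and $n$, $D_c(f_c^n(0))$ denotes the derivative, evaluated at the given parameter $c$, of the real function $t\mapsto f_t^n(0)$ of the parameter $t\in\mathbb{R}$, where $f_t(x)=|x|^r+t$. *)

theory Defs
  imports "HOL-Analysis.Analysis" "HOL-Computational_Algebra.Polynomial"
begin

text \<open>
  Since \<open>0 powr r = 0\<close>, the term \<open>\<bar>x\<bar> powr r\<close> is the usual power also at \<open>x = 0\<close>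
  when \<open>r > 0\<close>.
\<close>

definition unicrit :: "real \<Rightarrow> real \<Rightarrow> real \<Rightarrow> real" where
  "unicrit r c x = \<bar>x\<bar> powr r + c"

end

theory Submission
  imports Defs "Jordan_Normal_Form.Char_Poly"
begin

text \<open>
  Write \<open>x\<^sub>j\<close> for the iterates of \<open>0\<close>, \<open>D\<^sub>j\<close> for their derivatives in the parameter, and
  \<open>r = p / q\<close> in lowest terms. The chain rule gives \<open>D\<^sub>1 = 1\<close> and
  \<open>D\<^sub>j\<^sub>+\<^sub>1 = 1 + (p / q) * a\<^sub>j * D\<^sub>j\<close> with \<open>a\<^sub>j = sgn x\<^sub>j * \<bar>x\<^sub>j\<bar> powr (r - 1)\<close>, as long as
  \<open>x\<^sub>j \<noteq> 0\<close>. All \<open>x\<^sub>j\<close> and \<open>a\<^sub>j\<close> are algebraic integers: these are closed under sums, products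
  and powers with nonnegative rational exponent of a nonnegative base, and \<open>r - 1 > 0\<close>. Clearing
  denominators, \<open>q ^ (n - 1) * D\<^sub>n = q ^ (n - 1) + p * B\<close> for an algebraic integer \<open>B\<close> (lemma
  \<open>unicrit_iterate_derivative_congruence\<close>). If \<open>D\<^sub>n = 0\<close>, then \<open>q ^ (n - 1) / p = - B\<close> is a
  rational algebraic integer, hence an integer, and coprimality forces \<open>p = 1\<close>, contrary to
  \<open>p > q \<ge> 1\<close>.

  The closure of algebraic integers under sums and products rests on the determinant trick: if
  multiplication by \<open>z\<close> maps the integer span of finitely many numbers, not all zero, to itself, then
  \<open>z\<close> is an eigenvalue of an integer matrix (lemma \<open>algebraic_int_if_span_stable\<close>). For algebraic
  integers \<open>x\<close> and \<open>y\<close>, finitely many of the products \<open>x ^ i * y ^ j\<close> span such a module, which is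
  stable under \<open>x\<close> and \<open>y\<close> and hence under \<open>x + y\<close> and \<open>x * y\<close>.
\<close>

section \<open>Algebraic integers form a ring\<close>

interpretation int_module: Modules.module "\<lambda>(k::int) (x::'a::field_char_0). of_int k * x"
  by unfold_locales (simp_all add: algebra_simps)

lemma int_span_mult_stable:
  fixes z :: "'a::field_char_0"
  assumes "\<And>s. s \<in> S \<Longrightarrow> z * s \<in> int_module.span S" and "v \<in> int_module.span S"
  shows "z * v \<in> int_module.span S"
  using assms(2)
proof (induction rule: int_module.span_induct_alt)
  case base
  show ?case by (simp add: int_module.span_zero)
next
  case (step k s v)
  have "z * (of_int k * s + v) = of_int k * (z * s) + z * v"
    by (simp add: algebra_simps)
  then show ?case
    using step assms(1) by (auto intro: int_module.span_add int_module.span_scale)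
qed

lemma algebraic_int_if_eigenvalue:
  fixes z :: "'a::field_char_0" and A :: "int mat"
  assumes A: "A \<in> carrier_mat n n" and ev: "eigenvalue (map_mat of_int A) z"
  shows "algebraic_int z"
  unfolding algebraic_int_altdef_ipoly
proof (intro exI conjI)
  show "lead_coeff (char_poly A) = 1"
    using degree_monic_char_poly[OF A] by simp
  have "map_mat (of_int :: int \<Rightarrow> 'a) A \<in> carrier_mat n n"
    using A by simp
  from eigenvalue_root_char_poly[OF this] ev
  show "poly (map_poly of_int (char_poly A)) z = 0"
    by (simp add: of_int_hom.char_poly_hom[OF A])
qed

text \<open>
  The coefficients expressing the products \<open>z * s\<close> form an integer matrix that has the vector
  of all elements of \<open>S\<close> as an eigenvector, with eigenvalue \<open>z\<close>.
\<close>

lemma algebraic_int_if_span_stable: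
  fixes z :: "'a::field_char_0"
  assumes fin: "finite S" and nz: "s0 \<in> S" "s0 \<noteq> 0"
    and stable: "\<And>s. s \<in> S \<Longrightarrow> z * s \<in> int_module.span S"
  shows "algebraic_int z"
proof -
  define n where "n = card S"
  obtain e where e: "bij_betw e {0..<n} S"
    unfolding n_def using ex_bij_betw_nat_finite[OF fin] by blast
  have "\<forall>s\<in>S. \<exists>u. z * s = (\<Sum>v\<in>S. of_int (u v) * v)"
    using stable unfolding int_module.span_finite[OF fin] by blast
  then obtain U where U: "\<And>s. s \<in> S \<Longrightarrow> z * s = (\<Sum>v\<in>S. of_int (U s v) * v)"
    by metis
  define A where "A = mat n n (\<lambda>(i, j). U (e i) (e j))"
  define v where "v = vec n e"
  have A: "A \<in> carrier_mat n n"
    by (simp add: A_def)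
  have "v \<noteq> 0\<^sub>v n"
  proof
    assume v0: "v = 0\<^sub>v n"
    obtain i where i: "i < n" "e i = s0"
      using nz(1) e by (metis atLeastLessThan_iff bij_betw_iff_bijections)
    have "v $ i = 0" using v0 i(1) by simp
    with i nz(2) show False by (simp add: v_def)
  qed
  moreover have "map_mat of_int A *\<^sub>v v = z \<cdot>\<^sub>v v"
  proof (rule eq_vecI)
    fix i assume "i < dim_vec (z \<cdot>\<^sub>v v)"
    then have i: "i < n" by (simp add: v_def)
    then have "e i \<in> S" using e by (auto simp: bij_betw_def)
    have "(map_mat of_int A *\<^sub>v v) $ i = (\<Sum>j\<in>{0..<n}. of_int (U (e i) (e j)) * e j)"
      using i by (simp add: A_def v_def scalar_prod_def)
    also have "\<dots> = (\<Sum>s\<in>S. of_int (U (e i) s) * s)"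
      by (rule sum.reindex_bij_betw[OF e])
    also have "\<dots> = (z \<cdot>\<^sub>v v) $ i"
      using U[OF \<open>e i \<in> S\<close>] i by (simp add: v_def)
    finally show "(map_mat of_int A *\<^sub>v v) $ i = (z \<cdot>\<^sub>v v) $ i" .
  qed (simp add: A_def v_def)
  ultimately have "eigenvalue (map_mat of_int A) z"
    unfolding eigenvalue_def eigenvector_def using A by (intro exI[of _ v]) (auto simp: v_def)
  with A show ?thesis by (rule algebraic_int_if_eigenvalue)
qed

lemma algebraic_int_power_reduction:
  fixes x :: "'a::field_char_0"
  assumes "algebraic_int x"
  obtains m a where "m > 0" "x ^ m = (\<Sum>i<m. of_int (a i) * x ^ i)"
proof -
  from assms obtain p where p: "poly (map_poly of_int p) x = 0" "lead_coeff p = 1"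
    unfolding algebraic_int_altdef_ipoly by blast
  define m where "m = degree p"
  have "0 = (\<Sum>i\<le>m. of_int (coeff p i) * x ^ i)"
    using p(1) by (simp add: poly_altdef degree_map_poly coeff_map_poly m_def)
  also have "\<dots> = (\<Sum>i<m. of_int (coeff p i) * x ^ i) + x ^ m"
    using p(2) by (simp add: m_def lessThan_Suc_atMost[symmetric])
  finally have eq: "(\<Sum>i<m. of_int (coeff p i) * x ^ i) + x ^ m = 0"
    by simp
  show thesis
  proof (rule that[of m "\<lambda>i. - coeff p i"])
    show "m > 0" using eq by (cases m) auto
    show "x ^ m = (\<Sum>i<m. of_int (- coeff p i) * x ^ i)"
      using eq by (simp add: sum_negf eq_neg_iff_add_eq_0 add.commute)
  qed
qed

text \<open>
  The common module for the sum and the product. Its generators are \<open>x ^ i * y ^ j\<close> below the degrees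
  of monic equations for \<open>x\<close> and \<open>y\<close>, and these equations reduce the powers that a multiplication
  pushes out of range.
\<close>

lemma algebraic_int_common_module:
  fixes x y :: "'a::field_char_0"
  assumes "algebraic_int x" "algebraic_int y"
  obtains S where "finite S" "1 \<in> S"
    "\<And>s. s \<in> S \<Longrightarrow> x * s \<in> int_module.span S" "\<And>s. s \<in> S \<Longrightarrow> y * s \<in> int_module.span S"
proof -
  obtain m a where m: "m > 0" and xm: "x ^ m = (\<Sum>i<m. of_int (a i) * x ^ i)"
    using assms(1) by (rule algebraic_int_power_reduction)
  obtain n b where n: "n > 0" and yn: "y ^ n = (\<Sum>j<n. of_int (b j) * y ^ j)"
    using assms(2) by (rule algebraic_int_power_reduction)
  define S where "S = (\<lambda>(i, j). x ^ i * y ^ j) ` ({..<m} \<times> {..<n})"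
  have inS: "x ^ i * y ^ j \<in> int_module.span S" if "i < m" "j < n" for i j
    using that by (intro int_module.span_base) (auto simp: S_def)
  show thesis
  proof (rule that[of S])
    show "finite S" by (simp add: S_def)
    show "1 \<in> S" using m n by (auto simp: S_def intro!: image_eqI[of _ _ "(0, 0)"])
  next
    fix s assume "s \<in> S"
    then obtain i j where ij: "i < m" "j < n" "s = x ^ i * y ^ j" by (auto simp: S_def)
    show "x * s \<in> int_module.span S"
    proof (cases "Suc i < m")
      case True
      then show ?thesis using inS[OF True ij(2)] ij(3) by (simp add: mult.assoc)
    next
      case False
      with ij(1) have "m = Suc i" by simp
      then have "x * s = x ^ m * y ^ j" using ij(3) by (simp add: mult.assoc)
      also have "\<dots> = (\<Sum>k<m. of_int (a k) * (x ^ k * y ^ j))"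
        by (simp add: xm sum_distrib_right mult.assoc)
      also have "\<dots> \<in> int_module.span S"
        using inS ij(2) by (intro int_module.span_sum int_module.span_scale) auto
      finally show ?thesis .
    qed
    show "y * s \<in> int_module.span S"
    proof (cases "Suc j < n")
      case True
      then show ?thesis using inS[OF ij(1) True] ij(3) by (simp add: mult.left_commute)
    next
      case False
      with ij(2) have "n = Suc j" by simp
      then have "y * s = x ^ i * y ^ n" using ij(3) by (simp add: mult.left_commute)
      also have "\<dots> = (\<Sum>k<n. of_int (b k) * (x ^ i * y ^ k))"
        by (simp add: yn sum_distrib_left mult.left_commute)
      also have "\<dots> \<in> int_module.span S"
        using inS ij(1) by (intro int_module.span_sum int_module.span_scale) auto
      finally show ?thesis .
    qed
  qed
qed

lemma algebraic_int_add:
  fixes x y :: "'a::field_char_0"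
  assumes "algebraic_int x" "algebraic_int y"
  shows "algebraic_int (x + y)"
proof -
  obtain S where S: "finite S" "1 \<in> S" "\<And>s. s \<in> S \<Longrightarrow> x * s \<in> int_module.span S"
      "\<And>s. s \<in> S \<Longrightarrow> y * s \<in> int_module.span S"
    using algebraic_int_common_module[OF assms] by metis
  have "(x + y) * s \<in> int_module.span S" if "s \<in> S" for s
    using int_module.span_add[OF S(3)[OF that] S(4)[OF that]] by (simp add: distrib_right)
  then show ?thesis
    using S(1,2) by (intro algebraic_int_if_span_stable[of S 1]) auto
qed

lemma algebraic_int_mult:
  fixes x y :: "'a::field_char_0"
  assumes "algebraic_int x" "algebraic_int y"
  shows "algebraic_int (x * y)"
proof -
  obtain S where S: "finite S" "1 \<in> S" "\<And>s. s \<in> S \<Longrightarrow> x * s \<in> int_module.span S"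
      "\<And>s. s \<in> S \<Longrightarrow> y * s \<in> int_module.span S"
    using algebraic_int_common_module[OF assms] by metis
  have "(x * y) * s \<in> int_module.span S" if "s \<in> S" for s
    using int_span_mult_stable[OF S(3) S(4)[OF that]] by (simp add: mult.assoc)
  then show ?thesis
    using S(1,2) by (intro algebraic_int_if_span_stable[of S 1]) auto
qed

lemma algebraic_int_power:
  fixes x :: "'a::field_char_0"
  assumes "algebraic_int x"
  shows "algebraic_int (x ^ k)"
  by (induction k) (use assms in \<open>auto intro: algebraic_int_mult\<close>)

lemma algebraic_int_powr:
  fixes x s :: real
  assumes "algebraic_int x" "x \<ge> 0" "s \<in> \<rat>" "s \<ge> 0"
  shows "algebraic_int (x powr s)"
proof (cases "x = 0")
  case False
  obtain a b :: nat where b: "b \<noteq> 0" and s: "\<bar>s\<bar> = real a / real b"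
    using assms(3) by (rule Rats_abs_nat_div_natE)
  have "x powr s = (x powr real a) powr (1 / real b)"
    using s assms(4) by (simp add: powr_powr)
  also have "\<dots> = root b (x ^ a)"
    using b assms(2) False by (simp add: powr_realpow root_powr_inverse)
  finally show ?thesis
    using assms(1) by (auto intro: algebraic_int_power)
qed simp

section \<open>The critical orbit and its parameter derivative\<close>

lemma algebraic_int_unicrit_iterate:
  fixes r c :: real
  assumes "r \<in> \<rat>" "r \<ge> 0" "algebraic_int c"
  shows "algebraic_int ((unicrit r c ^^ n) 0)"
proof (induction n)
  case (Suc n)
  then show ?case
    using assms by (auto simp: unicrit_def intro!: algebraic_int_add algebraic_int_powr)
qed simp

lemma has_real_derivative_abs:
  fixes u :: real
  assumes "u \<noteq> 0"
  shows "(abs has_real_derivative sgn u) (at u)"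
proof (rule has_field_derivative_transform_within_open)
  show "((\<lambda>x. sgn u * x) has_real_derivative sgn u) (at u)"
    by (auto intro!: derivative_eq_intros)
  show "open (if u > 0 then {0<..} else {..<0::real})" by simp
qed (use assms in \<open>auto split: if_splits\<close>)

lemma has_real_derivative_unicrit:
  fixes g :: "real \<Rightarrow> real"
  assumes g: "(g has_real_derivative D) (at c)" and nz: "g c \<noteq> 0"
  shows "((\<lambda>t. unicrit r t (g t)) has_real_derivative
           r * (sgn (g c) * \<bar>g c\<bar> powr (r - 1)) * D + 1) (at c)"
proof -
  have "((\<lambda>t. \<bar>g t\<bar>) has_real_derivative sgn (g c) * D) (at c)"
    using DERIV_chain2[OF has_real_derivative_abs[OF nz] g] .
  then have "((\<lambda>t. \<bar>g t\<bar> powr r) has_real_derivative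
      r * \<bar>g c\<bar> powr (r - 1) * (sgn (g c) * D)) (at c)"
    using nz by (intro DERIV_chain2[OF has_real_derivative_powr]) auto
  from DERIV_add[OF this DERIV_ident] show ?thesis
    by (simp add: unicrit_def mult_ac)
qed

text \<open>
  Each step of the recursion for the derivative introduces one more factor \<open>q\<close> in the
  denominator, while all terms except the leading \<open>1\<close> carry a factor \<open>p\<close>.
\<close>

lemma unicrit_iterate_derivative_congruence:
  fixes c :: real and p q n :: nat
  assumes q: "q > 0" and r1: "real p / real q \<ge> 1" and c: "algebraic_int c"
    and nz: "\<forall>j\<in>{1..n}. (unicrit (real p / real q) c ^^ j) 0 \<noteq> 0"
  shows "\<exists>D B. ((\<lambda>t. (unicrit (real p / real q) t ^^ Suc n) 0) has_real_derivative D) (at c) \<and>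
           algebraic_int B \<and> real q ^ n * D = real q ^ n + real p * B"
  using nz
proof (induction n)
  case 0
  have "((\<lambda>t. (unicrit (real p / real q) t ^^ Suc 0) 0) has_real_derivative 1) (at c)"
    by (auto simp: unicrit_def)
  then show ?case by (intro exI[of _ 1] exI[of _ 0]) simp
next
  case (Suc n)
  define r where "r = real p / real q"
  from Suc obtain D B where D: "((\<lambda>t. (unicrit r t ^^ Suc n) 0) has_real_derivative D) (at c)"
      and B: "algebraic_int B" and eq: "real q ^ n * D = real q ^ n + real p * B"
    unfolding r_def by auto
  define x where "x = (unicrit r c ^^ Suc n) 0"
  define a where "a = sgn x * \<bar>x\<bar> powr (r - 1)"
  have r: "r \<in> \<rat>" "r \<ge> 1"
    using r1 by (auto simp: r_def)
  have "algebraic_int x"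
    unfolding x_def using r c by (intro algebraic_int_unicrit_iterate) auto
  then have "algebraic_int (\<bar>x\<bar> powr (r - 1))"
    using r by (intro algebraic_int_powr) auto
  then have a: "algebraic_int a"
    unfolding a_def by (intro algebraic_int_mult) (auto simp: sgn_if)
  have "x \<noteq> 0"
    using Suc.prems unfolding x_def r_def by (metis atLeastAtMost_iff le_refl le_add1 plus_1_eq_Suc)
  then have deriv: "((\<lambda>t. (unicrit r t ^^ Suc (Suc n)) 0) has_real_derivative r * a * D + 1) (at c)"
    using has_real_derivative_unicrit[OF D] unfolding a_def x_def by simp
  have "real q ^ Suc n * (r * a * D + 1) = real q ^ Suc n + real p * (a * (real q ^ n * D))"
    using q by (simp add: r_def field_simps)
  also have "\<dots> = real q ^ Suc n + real p * (a * (real q ^ n + real p * B))"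
    by (simp only: eq)
  finally have "real q ^ Suc n * (r * a * D + 1)
      = real q ^ Suc n + real p * (a * (real q ^ n + real p * B))" .
  moreover have "algebraic_int (a * (real q ^ n + real p * B))"
    using a B by (intro algebraic_int_mult algebraic_int_add algebraic_int_power) auto
  ultimately show ?case
    using deriv unfolding r_def by blast
qed

theorem proposition1p2:
  fixes r c :: real and n :: nat
  assumes "r \<in> \<rat>" and "r > 1"
    and "algebraic_int c"
    and "n \<ge> 1"
    and "\<forall>j\<in>{1..n-1}. (unicrit r c ^^ j) 0 \<noteq> 0"
  shows "(\<lambda>t. (unicrit r t ^^ n) 0) differentiable (at c) \<and>
         deriv (\<lambda>t. (unicrit r t ^^ n) 0) c \<noteq> 0"
proof -
  obtain p q :: nat where q: "q \<noteq> 0" and pq: "\<bar>r\<bar> = real p / real q" and cop: "coprime p q"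
    using assms(1) by (rule Rats_abs_nat_div_natE)
  have r: "r = real p / real q" using pq assms(2) by simp
  have p: "p > q" using assms(2) q unfolding r by (simp add: field_simps)
  obtain k where k: "n = Suc k" using assms(4) by (cases n) auto
  obtain D B where D: "((\<lambda>t. (unicrit r t ^^ n) 0) has_real_derivative D) (at c)"
      and B: "algebraic_int B" and eq: "real q ^ k * D = real q ^ k + real p * B"
    using unicrit_iterate_derivative_congruence[of q p c k] assms q
    unfolding r k by auto
  have "D \<noteq> 0"
  proof
    assume "D = 0"
    then have Beq: "B = - (real q ^ k / real p)"
      using eq p by (simp add: field_simps)
    then have "B \<in> \<rat>" by simp
    with B have "B \<in> \<int>" by (rule rational_algebraic_int_is_int)
    then obtain z where "B = of_int z" by (auto elim: Ints_cases)
    with Beq p have "real_of_int (int q ^ k) = real_of_int (int p * - z)"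
      by (simp add: field_simps)
    then have "int q ^ k = int p * - z" by (simp only: of_int_eq_iff)
    then have "int p dvd int (q ^ k)" by simp
    then have "p dvd q ^ k" by (simp only: int_dvd_int_iff)
    then have "p = 1" using cop by (metis coprime_power_right_iff coprime_absorb_left nat_dvd_1_iff_1)
    with p q show False by simp
  qed
  with D show ?thesis
    by (auto simp: DERIV_imp_deriv real_differentiable_def)
qed

end
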